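(* Let $M$ be a real $r\times c$ matrix (a zero-sum game where the row player $\textsc{Min}$ pays $M_{ij}$ to the column player $\textsc{Max}$), let $M_{\min}=\min_{i,j}M_{ij}$, $M_{\max}=\max_{i,j}M_{ij}$, and $\mathrm{val}(M)=\min_p\max_j\sum_ip(i)M_{ij}$ with $p$ ranging over probability distributions on the rows. For any $\epsilon>0$ and any positive integer $k\ge\log_{1+\epsilon}c$, \[ \min_{|S|=k}\ \max_j\ \min_{i\in S} M_{ij}\ \le\ \mathrm{val}(M)+\epsilon\,(\mathrm{val}(M)-M_{\min}), \] where $S$ ranges over collections of $k$ rows; equality can hold only if $k=\log_{1+\epsilon}c$. Symmetrically, for any $\epsilon>0$ and positive integer $k\ge\log_{1+\epsilon}r$, \[ \max_{|T|=k}\ \min_i\ \max_{j\in T} M_{ij}\ \ge\ \mathrm{val}(M)-\epsilon\,(M_{\max}-\mathrm{val}(M)), \] where $T$ ranges over collections of $k$ columns, with equality possible only if $k=\log_{1+\epsilon}r$.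
   Context: $\mathrm{val}(M)$ is the value of the zero-sum game; by von Neumann's Min-Max Theorem it also equals $\max_q\min_i\sum_jq(j)M_{ij}$ with $q$ ranging over probability distributions on the columns.
   Formalization: The "equality only if" clauses are stated under val(M) > M_min (first half) and val(M) < M_max (second half); otherwise, e.g. for a constant matrix, equality holds for every k and ε. Collections may repeat rows or columns, so k may exceed r or c. *)

theory Defs
  imports "HOL-Probability.Probability"
begin

text \<open>A matrix \<^term>\<open>M :: real ^ 'c ^ 'r\<close> has rows indexed by \<open>'r\<close> and columns by \<open>'c\<close>;
  \<^term>\<open>M $ i $ j\<close> is the payment from Min, who picks \<^term>\<open>i\<close>, to Max, who picks \<^term>\<open>j\<close>.\<close>

definition min_entry :: "real ^ 'c ^ 'r \<Rightarrow> real"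
  where "min_entry M = Min (range (\<lambda>(i, j). M $ i $ j))"

definition max_entry :: "real ^ 'c ^ 'r \<Rightarrow> real"
  where "max_entry M = Max (range (\<lambda>(i, j). M $ i $ j))"

definition mixed_cost :: "real ^ 'c ^ 'r \<Rightarrow> 'r pmf \<Rightarrow> real"
  where "mixed_cost M p = (MAX j. \<Sum>i\<in>UNIV. pmf p i * M $ i $ j)"

text \<open>The infimum is a minimum, see \<open>game_val_attained\<close>.\<close>

definition game_val :: "real ^ 'c ^ 'r \<Rightarrow> real"
  where "game_val M = (INF p. mixed_cost M p)"

text \<open>A collection of \<^term>\<open>k\<close> rows (or columns) is a multiset, so that \<^term>\<open>k\<close> may exceed the
  number of rows. For \<^term>\<open>k\<close> at most the number of rows, sets give the same
  value: see \<open>collection_cost_sets\<close>.\<close>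

definition collection_cost :: "nat \<Rightarrow> real ^ 'c ^ 'r \<Rightarrow> real"
  where "collection_cost k M =
    (MIN S\<in>multisets_of_size UNIV k. MAX j. MIN i\<in>set_mset S. M $ i $ j)"

definition collection_gain :: "nat \<Rightarrow> real ^ 'c ^ 'r \<Rightarrow> real"
  where "collection_gain k M =
    (MAX T\<in>multisets_of_size UNIV k. MIN i. MAX j\<in>set_mset T. M $ i $ j)"

lemma continuous_on_MAX:
  fixes f :: "'j \<Rightarrow> 'a::topological_space \<Rightarrow> real"
  assumes "finite J" "J \<noteq> {}" "\<And>j. j \<in> J \<Longrightarrow> continuous_on A (f j)"
  shows "continuous_on A (\<lambda>x. MAX j\<in>J. f j x)"
  using assms
proof (induction J rule: finite_ne_induct)
  case (singleton j)
  then show ?case by simp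
next
  case (insert j J)
  then have "continuous_on A (\<lambda>x. max (f j x) (MAX j\<in>J. f j x))"
    by (intro continuous_on_max) auto
  with insert show ?case by simp
qed

lemma game_val_attained:
  fixes M :: "real ^ 'c ^ 'r"
  shows "\<exists>p. mixed_cost M p = game_val M \<and> (\<forall>q. mixed_cost M p \<le> mixed_cost M q)"
proof -
  define K where "K = {x :: real ^ 'r. (\<forall>i. 0 \<le> x $ i) \<and> (\<Sum>i\<in>UNIV. x $ i) = 1}"
  define g where "g = (\<lambda>x :: real ^ 'r. MAX j. \<Sum>i\<in>UNIV. x $ i * M $ i $ j)"
  have pmf_K: "(\<chi> i. pmf p i) \<in> K" for p :: "'r pmf"
    by (simp add: K_def sum_pmf_eq_1)
  have g_pmf: "g (\<chi> i. pmf p i) = mixed_cost M p" for p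
    by (simp add: g_def mixed_cost_def)
  have "K = (\<Inter>i. {x. 0 \<le> x $ i}) \<inter> {x. (\<Sum>i\<in>UNIV. x $ i) = 1}"
    by (auto simp: K_def)
  moreover have "closed \<dots>"
    by (intro closed_Int closed_INT ballI closed_Collect_le closed_Collect_eq continuous_intros)
  ultimately have "closed K" by simp
  moreover have "bounded K"
  proof (rule boundedI)
    fix x assume "x \<in> K"
    have "norm x \<le> (\<Sum>i\<in>UNIV. \<bar>x $ i\<bar>)" by (rule norm_le_l1_cart)
    also have "\<dots> = 1" using \<open>x \<in> K\<close> by (simp add: K_def)
    finally show "norm x \<le> 1" .
  qed
  ultimately have "compact K" by (simp add: compact_eq_bounded_closed)
  moreover have "K \<noteq> {}" using pmf_K by blast
  moreover have "continuous_on K g"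
    unfolding g_def by (intro continuous_on_MAX continuous_intros) auto
  ultimately obtain x where x: "x \<in> K" "\<And>y. y \<in> K \<Longrightarrow> g x \<le> g y"
    using continuous_attains_inf by metis
  define p where "p = embed_pmf (\<lambda>i. x $ i)"
  have "pmf p i = x $ i" for i
    unfolding p_def using x(1)
    by (intro pmf_embed_pmf) (auto simp: K_def nn_integral_count_space_finite)
  then have "mixed_cost M p = g x" by (simp add: g_def mixed_cost_def)
  then have least: "mixed_cost M p \<le> mixed_cost M q" for q
    using x(2)[OF pmf_K[of q]] g_pmf by simp
  then have "game_val M = mixed_cost M p"
    unfolding game_val_def by (intro cInf_eq_minimum) auto
  with least show ?thesis by auto
qed

lemma min_entry_le: "min_entry M \<le> M $ i $ j"
  unfolding min_entry_def by (rule Min_le) (auto intro: rev_image_eqI[of "(i, j)"])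

lemma collection_cost_le:
  fixes M :: "real ^ 'c ^ 'r"
  assumes "size S = k"
  shows "collection_cost k M \<le> (MAX j. MIN i\<in>set_mset S. M $ i $ j)"
  unfolding collection_cost_def using assms
  by (intro Min_le finite_imageI finite_multisets_of_size) (auto simp: multisets_of_size_def)

lemma collection_cost_attained:
  fixes M :: "real ^ 'c ^ 'r"
  obtains S where "size S = k" "collection_cost k M = (MAX j. MIN i\<in>set_mset S. M $ i $ j)"
proof -
  have "replicate_mset k undefined \<in> multisets_of_size (UNIV :: 'r set) k"
    by (simp add: multisets_of_size_def)
  then have "collection_cost k M \<in>
      (\<lambda>S. MAX j. MIN i\<in>set_mset S. M $ i $ j) ` multisets_of_size UNIV k"
    unfolding collection_cost_def
    by (intro Min_in finite_imageI finite_multisets_of_size) auto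
  then show ?thesis using that by (auto simp: multisets_of_size_def)
qed

lemma collection_cost_sets:
  fixes M :: "real ^ 'c ^ 'r"
  assumes "0 < k" "k \<le> CARD('r)"
  shows "collection_cost k M = (MIN S\<in>{S. card S = k}. MAX j. MIN i\<in>S. M $ i $ j)"
proof (rule antisym)
  let ?f = "\<lambda>S. MAX j. MIN i\<in>S. M $ i $ j"
  have ne: "{S :: 'r set. card S = k} \<noteq> {}"
    using obtain_subset_with_card_n[OF assms(2)] by auto
  have "collection_cost k M \<le> ?f S" if "card S = k" for S
    using collection_cost_le[of "mset_set S" k M] that by simp
  with ne show "collection_cost k M \<le> (MIN S\<in>{S. card S = k}. ?f S)"
    by (intro Min.boundedI) auto
  obtain S where S: "size S = k" "collection_cost k M = ?f (set_mset S)"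
    by (rule collection_cost_attained)
  have "card (set_mset S) \<le> k"
    using S(1) size_mset_mono[OF mset_set_set_mset_msubset[of S]] by simp
  then obtain T where T: "set_mset S \<subseteq> T" "card T = k"
    using exists_subset_between[of "set_mset S" k UNIV] assms by auto
  have "S \<noteq> {#}" using S assms by auto
  then have "(MIN i\<in>T. M $ i $ j) \<le> (MIN i\<in>set_mset S. M $ i $ j)" for j
    using T(1) by (intro Min_antimono) auto
  then have "(MIN i\<in>T. M $ i $ j) \<le> ?f (set_mset S)" for j
    by (rule order.trans) (intro Max_ge; auto)
  then have "?f T \<le> ?f (set_mset S)"
    by (intro Max.boundedI) auto
  moreover have "(MIN S\<in>{S. card S = k}. ?f S) \<le> ?f T"
    using T(2) by (intro Min_le) auto
  ultimately show "(MIN S\<in>{S. card S = k}. ?f S) \<le> collection_cost k M"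
    unfolding S(2) by (meson order.trans)
qed

text \<open>In the degenerate case \<^term>\<open>game_val M = min_entry M\<close> (a constant matrix, say) the bound
  \<^term>\<open>game_val M + \<epsilon> * (game_val M - min_entry M)\<close> is attained for all \<^term>\<open>k\<close> and \<open>\<epsilon>\<close>.\<close>

lemma collection_cost_degenerate:
  fixes M :: "real ^ 'c ^ 'r"
  assumes "game_val M = min_entry M" "0 < k"
  shows "collection_cost k M = game_val M + \<epsilon> * (game_val M - min_entry M)"
proof -
  obtain p where p: "mixed_cost M p = min_entry M" using game_val_attained[of M] assms by auto
  obtain i where i: "i \<in> set_pmf p" using set_pmf_not_empty[of p] by blast
  have Mi: "M $ i $ j = min_entry M" for j
  proof -
    have nn: "0 \<le> pmf p i * (M $ i $ j - min_entry M)" for i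
      using min_entry_le[of M i j] by simp
    have "(\<Sum>i\<in>UNIV. pmf p i * M $ i $ j) \<le> mixed_cost M p"
      unfolding mixed_cost_def by (intro Max_ge) auto
    then have "(\<Sum>i\<in>UNIV. pmf p i * (M $ i $ j - min_entry M)) \<le> 0"
      using p sum_pmf_eq_1[of UNIV p]
      by (simp add: algebra_simps sum_subtractf flip: sum_distrib_left)
    moreover have "pmf p i * (M $ i $ j - min_entry M)
        \<le> (\<Sum>i\<in>UNIV. pmf p i * (M $ i $ j - min_entry M))"
      using nn by (intro member_le_sum) auto
    ultimately have "pmf p i * (M $ i $ j - min_entry M) = 0"
      using nn[of i] by linarith
    then show ?thesis using i by (simp add: set_pmf_iff)
  qed
  have le: "collection_cost k M \<le> min_entry M"
    using collection_cost_le[of "replicate_mset k i" k M] assms(2) by (simp add: Mi)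
  obtain S where S: "size S = k"
      "collection_cost k M = (MAX j. MIN i\<in>set_mset S. M $ i $ j)"
    by (rule collection_cost_attained)
  have "S \<noteq> {#}" using S assms by auto
  then have "min_entry M \<le> (MIN i\<in>set_mset S. M $ i $ undefined)"
    using min_entry_le by (intro Min.boundedI) auto
  also have "\<dots> \<le> collection_cost k M" unfolding S(2) by (intro Max_ge) auto
  finally have "min_entry M \<le> collection_cost k M" .
  with le show ?thesis using assms(1) by simp
qed

end

theory Submission
  imports Defs
begin

text \<open>If Min samples a row from an optimal mixed strategy, then by Markov's inequality a fixed
  column \<open>j\<close> pays more than \<open>val M + \<epsilon> (val M - M\<^sub>m\<^sub>i\<^sub>n)\<close> with probability less than
  \<open>1 / (1 + \<epsilon>)\<close>. So with \<open>k\<close> independent rows the expected number of columns that exceed the bound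
  on all of them is less than \<open>c / (1 + \<epsilon>)\<^sup>k \<le> 1\<close>, and some choice has no such column. The
  statement for Max is the one for Min in the game \<open>- M\<^sup>T\<close>, whose value is \<open>- val M\<close> by the
  minimax theorem.\<close>

section \<open>Averaging and greedy choice of rows\<close>

lemma exists_le_average_pmf:
  fixes f :: "'r::finite \<Rightarrow> real"
  assumes "(\<Sum>i\<in>UNIV. pmf p i * f i) \<le> b"
  shows "\<exists>i. f i \<le> b"
proof (rule ccontr)
  assume "\<nexists>i. f i \<le> b"
  then have gt: "f i > b" for i by (simp add: not_le)
  \<comment> \<open>Outside the support the two summands agree, so strictness has to come from a row
    of positive mass.\<close>
  obtain i where i: "pmf p i > 0" using set_pmf_not_empty[of p] pmf_positive by fast
  have "(\<Sum>i\<in>UNIV. pmf p i * b) < (\<Sum>i\<in>UNIV. pmf p i * f i)"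
  proof (rule sum_strict_mono_ex1)
    show "\<forall>i\<in>UNIV. pmf p i * b \<le> pmf p i * f i"
      using gt by (simp add: mult_left_mono less_imp_le)
    show "\<exists>i\<in>UNIV. pmf p i * b < pmf p i * f i"
      using i gt by (intro bexI[of _ i]) auto
  qed simp
  moreover have "(\<Sum>i\<in>UNIV. pmf p i * b) = b"
    by (simp add: sum_pmf_eq_1 flip: sum_distrib_right)
  ultimately show False using assms by linarith
qed

text \<open>Picking rows greedily derandomises the union bound: some row does at least as well as the average over \<^term>\<open>p\<close>, so each pick shrinks the set of columns that are bad for
  all rows picked so far by the factor \<open>\<delta>\<close>.\<close>

lemma exists_multiset_few_bad_columns:
  fixes bad :: "'r::finite \<Rightarrow> 'c::finite \<Rightarrow> bool"
  assumes bad: "\<And>j. (\<Sum>i\<in>UNIV. pmf p i * of_bool (bad i j)) \<le> \<delta>"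
  shows "\<exists>S. size S = k \<and> real (card {j. \<forall>i\<in>#S. bad i j}) \<le> real CARD('c) * \<delta> ^ k"
proof (induction k)
  case 0
  show ?case by simp
next
  case (Suc k)
  then obtain S where S: "size S = k"
      "real (card {j. \<forall>i\<in>#S. bad i j}) \<le> real CARD('c) * \<delta> ^ k"
    by blast
  have "0 \<le> (\<Sum>i\<in>UNIV. pmf p i * of_bool (bad i undefined))" by (intro sum_nonneg) auto
  then have \<delta>: "0 \<le> \<delta>" using bad[of undefined] by linarith
  let ?J = "{j. \<forall>i\<in>#S. bad i j}"
  have card_eq: "real (card {j \<in> ?J. bad i j}) = (\<Sum>j\<in>?J. of_bool (bad i j))" for i
    by (simp add: Int_def)
  \<comment> \<open>Exchanging the sums turns the expected number of columns that stay bad into a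
    sum of the column probabilities bounded by \<open>bad\<close>.\<close>
  have "(\<Sum>i\<in>UNIV. pmf p i * real (card {j \<in> ?J. bad i j}))
      = (\<Sum>j\<in>?J. \<Sum>i\<in>UNIV. pmf p i * of_bool (bad i j))"
    unfolding card_eq sum_distrib_left by (rule sum.swap)
  also have "\<dots> \<le> (\<Sum>j\<in>?J. \<delta>)" by (intro sum_mono bad)
  finally have "(\<Sum>i\<in>UNIV. pmf p i * real (card {j \<in> ?J. bad i j})) \<le> real (card ?J) * \<delta>"
    by simp
  then obtain i where i: "real (card {j \<in> ?J. bad i j}) \<le> real (card ?J) * \<delta>"
    using exists_le_average_pmf[of p "\<lambda>i. real (card {j \<in> ?J. bad i j})"] by blast
  have "{j. \<forall>i\<in>#add_mset i S. bad i j} = {j \<in> ?J. bad i j}" by auto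
  then have "real (card {j. \<forall>i\<in>#add_mset i S. bad i j}) \<le> real (card ?J) * \<delta>"
    using i by simp
  also have "\<dots> \<le> real CARD('c) * \<delta> ^ k * \<delta>"
    using S(2) \<delta> by (intro mult_right_mono)
  finally show ?case using S(1) by (intro exI[of _ "add_mset i S"]) (simp add: mult_ac)
qed

text \<open>A number of bad columns below 1 is 0.\<close>

lemma exists_multiset_no_bad_column:
  fixes bad :: "'r::finite \<Rightarrow> 'c::finite \<Rightarrow> bool"
  assumes "\<And>j. (\<Sum>i\<in>UNIV. pmf p i * of_bool (bad i j)) \<le> \<delta>"
    and "real CARD('c) * \<delta> ^ k < 1"
  shows "\<exists>S. size S = k \<and> (\<forall>j. \<exists>i\<in>#S. \<not> bad i j)"
proof -
  obtain S where S: "size S = k" "real (card {j. \<forall>i\<in>#S. bad i j}) \<le> real CARD('c) * \<delta> ^ k"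
    using exists_multiset_few_bad_columns[of p bad \<delta> k, OF assms(1)] by blast
  then have "card {j. \<forall>i\<in>#S. bad i j} = 0" using assms(2) by linarith
  then have "{j. \<forall>i\<in>#S. bad i j} = {}" by simp
  with S(1) show ?thesis by blast
qed

section \<open>Markov's inequality and the bound for Min\<close>

lemma collection_cost_leI:
  fixes M :: "real ^ 'c ^ 'r"
  assumes "size S = k" "\<And>j. \<exists>i\<in>#S. M $ i $ j \<le> b"
  shows "collection_cost k M \<le> b"
proof -
  have "(MIN i\<in>set_mset S. M $ i $ j) \<le> b" for j
    using assms(2)[of j] by (auto intro: Min_le[THEN order_trans])
  then have "(MAX j. MIN i\<in>set_mset S. M $ i $ j) \<le> b" by (intro Max.boundedI) auto
  with collection_cost_le[OF assms(1), of M] show ?thesis by linarith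
qed

lemma collection_cost_lessI:
  fixes M :: "real ^ 'c ^ 'r"
  assumes "size S = k" "\<And>j. \<exists>i\<in>#S. M $ i $ j < b"
  shows "collection_cost k M < b"
proof -
  have "(MIN i\<in>set_mset S. M $ i $ j) < b" for j
    using assms(2)[of j] by (auto intro: Min_le[THEN order.strict_trans1])
  then have "(MAX j. MIN i\<in>set_mset S. M $ i $ j) < b" by simp
  with collection_cost_le[OF assms(1), of M] show ?thesis by linarith
qed

lemma sum_pmf_le_mixed_cost:
  fixes M :: "real ^ 'c ^ 'r"
  shows "(\<Sum>i\<in>UNIV. pmf p i * M $ i $ j) \<le> mixed_cost M p"
  unfolding mixed_cost_def by (intro Max_ge) auto

text \<open>Markov's inequality for the nonnegative \<open>f i - m\<close>, whose mean is at most
  \<open>v - m\<close>, at the threshold \<open>(1 + \<epsilon>) * (v - m)\<close>. Making the event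
  strict makes the bound on its probability strict.\<close>

lemma markov_pmf:
  fixes f :: "'r::finite \<Rightarrow> real"
  assumes "\<And>i. m \<le> f i" "(\<Sum>i\<in>UNIV. pmf p i * f i) \<le> v" "m < v" "0 < \<epsilon>"
  shows "(\<Sum>i\<in>UNIV. pmf p i * of_bool (v + \<epsilon> * (v - m) \<le> f i)) \<le> 1 / (1 + \<epsilon>)"
    and "(\<Sum>i\<in>UNIV. pmf p i * of_bool (v + \<epsilon> * (v - m) < f i)) < 1 / (1 + \<epsilon>)"
proof -
  let ?t = "(1 + \<epsilon>) * (v - m)"
  have eq: "v + \<epsilon> * (v - m) = m + ?t" by (simp add: algebra_simps)
  have cancel_le: "x \<le> 1 / (1 + \<epsilon>)" if "x * ?t \<le> v - m" for x
  proof -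
    have "(x * (1 + \<epsilon>)) * (v - m) \<le> 1 * (v - m)" using that by (simp add: mult.assoc)
    then show ?thesis using assms by (simp add: pos_le_divide_eq)
  qed
  have cancel_less: "x < 1 / (1 + \<epsilon>)" if "x * ?t < v - m" for x
  proof -
    have "(x * (1 + \<epsilon>)) * (v - m) < 1 * (v - m)" using that by (simp add: mult.assoc)
    then show ?thesis using assms by (simp add: pos_less_divide_eq)
  qed
  have mean: "(\<Sum>i\<in>UNIV. pmf p i * (f i - m)) \<le> v - m"
    using assms(2) sum_pmf_eq_1[of UNIV p]
    by (simp add: algebra_simps sum_subtractf flip: sum_distrib_left)
  have bnd: "pmf p i * of_bool (m + ?t \<le> f i) * ?t \<le> pmf p i * (f i - m)" for i
    using assms(1)[of i] by (auto simp: mult.assoc intro!: mult_left_mono)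
  have "(\<Sum>i\<in>UNIV. pmf p i * of_bool (m + ?t \<le> f i)) * ?t \<le> v - m"
    unfolding sum_distrib_right by (rule order_trans[OF sum_mono mean]) (rule bnd)
  then show "(\<Sum>i\<in>UNIV. pmf p i * of_bool (v + \<epsilon> * (v - m) \<le> f i)) \<le> 1 / (1 + \<epsilon>)"
    unfolding eq by (rule cancel_le)
  have "(\<Sum>i\<in>UNIV. pmf p i * of_bool (m + ?t < f i)) * ?t < v - m"
  \<comment> \<open>A row of positive mass in the event makes Markov's estimate strict, since there
    \<open>?t < f i - m\<close>. Without such a row the event has probability 0, and
    \<open>0 < v - m\<close>.\<close>
  proof (cases "\<exists>i. 0 < pmf p i \<and> m + ?t < f i")
    case True
    then obtain i where i: "0 < pmf p i" "m + ?t < f i" by blast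
    have "(\<Sum>i\<in>UNIV. pmf p i * of_bool (m + ?t < f i) * ?t) < (\<Sum>i\<in>UNIV. pmf p i * (f i - m))"
    proof (rule sum_strict_mono_ex1)
      show "\<forall>i\<in>UNIV. pmf p i * of_bool (m + ?t < f i) * ?t \<le> pmf p i * (f i - m)"
        using assms(1) by (auto simp: mult.assoc intro!: mult_left_mono)
      show "\<exists>i\<in>UNIV. pmf p i * of_bool (m + ?t < f i) * ?t < pmf p i * (f i - m)"
        using i by (intro bexI[of _ i]) auto
    qed simp
    then show ?thesis unfolding sum_distrib_right using mean by (rule order.strict_trans2)
  next
    case False
    then have "pmf p i * of_bool (m + ?t < f i) = 0" for i
      using pmf_nonneg[of p i] by (auto simp: order.order_iff_strict)
    then have "(\<Sum>i\<in>UNIV. pmf p i * of_bool (m + ?t < f i)) = 0" by (intro sum.neutral) blast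
    with assms(3) show ?thesis by (simp only: mult_zero_left diff_gt_0_iff_gt)
  qed
  then show "(\<Sum>i\<in>UNIV. pmf p i * of_bool (v + \<epsilon> * (v - m) < f i)) < 1 / (1 + \<epsilon>)"
    unfolding eq by (rule cancel_less)
qed

text \<open>Strictness of \<open>c / (1 + \<epsilon>) ^ k < 1\<close> has two possible sources. For
  the weak bound, bad means above \<open>?b\<close>, and Markov's inequality is strict, which allows
  \<open>c = (1 + \<epsilon>) ^ k\<close>. For the strict bound, bad means at least
  \<open>?b\<close>, and strictness comes from \<open>k\<close>.\<close>

lemma collection_cost_bound:
  fixes M :: "real ^ 'c ^ 'r"
  assumes "\<epsilon> > 0" "k > 0" "min_entry M < game_val M"
    and k: "log (1 + \<epsilon>) (real CARD('c)) \<le> real k"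
  shows "collection_cost k M \<le> game_val M + \<epsilon> * (game_val M - min_entry M)"
    and "log (1 + \<epsilon>) (real CARD('c)) < real k \<Longrightarrow>
      collection_cost k M < game_val M + \<epsilon> * (game_val M - min_entry M)"
proof -
  let ?b = "game_val M + \<epsilon> * (game_val M - min_entry M)"
  obtain p where p: "mixed_cost M p = game_val M" using game_val_attained by blast
  have sum_le: "(\<Sum>i\<in>UNIV. pmf p i * M $ i $ j) \<le> game_val M" for j
    using sum_pmf_le_mixed_cost[of p M j] p by simp
  note markov = markov_pmf[OF min_entry_le sum_le assms(3,1)]
  \<comment> \<open>The maximum over the finitely many columns keeps the strict inequality while
    making it uniform in \<open>j\<close>.\<close>
  define \<delta> where "\<delta> = (MAX j. \<Sum>i\<in>UNIV. pmf p i * of_bool (?b < M $ i $ j))"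
  have \<delta>_ge: "(\<Sum>i\<in>UNIV. pmf p i * of_bool (?b < M $ i $ j)) \<le> \<delta>" for j
    unfolding \<delta>_def by (intro Max_ge) auto
  have "0 \<le> (\<Sum>i\<in>UNIV. pmf p i * of_bool (?b < M $ i $ undefined))"
    by (intro sum_nonneg) auto
  then have "0 \<le> \<delta>" using \<delta>_ge[of undefined] by linarith
  have "\<delta> < 1 / (1 + \<epsilon>)" unfolding \<delta>_def using markov(2) by simp
  have "real CARD('c) \<le> (1 + \<epsilon>) ^ k"
    using k assms(1) by (simp add: log_le_iff powr_realpow)
  have "real CARD('c) * \<delta> ^ k < real CARD('c) * (1 / (1 + \<epsilon>)) ^ k"
    using \<open>0 \<le> \<delta>\<close> \<open>\<delta> < _\<close> assms(2) by (intro mult_strict_left_mono power_strict_mono) auto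
  also have "\<dots> \<le> 1"
    using \<open>real CARD('c) \<le> _\<close> assms(1) by (simp add: power_one_over field_simps)
  finally obtain S where "size S = k" "\<And>j. \<exists>i\<in>#S. \<not> ?b < M $ i $ j"
    using exists_multiset_no_bad_column[of p "\<lambda>i j. ?b < M $ i $ j", OF \<delta>_ge] by blast
  then show "collection_cost k M \<le> ?b" by (intro collection_cost_leI) (auto simp: not_less)
  assume "log (1 + \<epsilon>) (real CARD('c)) < real k"
  then have "real CARD('c) < (1 + \<epsilon>) ^ k"
    using assms(1) by (simp add: log_less_iff powr_realpow)
  then have "real CARD('c) * (1 / (1 + \<epsilon>)) ^ k < 1"
    using assms(1) by (simp add: power_one_over field_simps)
  then obtain S where "size S = k" "\<And>j. \<exists>i\<in>#S. \<not> ?b \<le> M $ i $ j"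
    using exists_multiset_no_bad_column[of p "\<lambda>i j. ?b \<le> M $ i $ j", OF markov(1)] by blast
  then show "collection_cost k M < ?b" by (intro collection_cost_lessI) (auto simp: not_le)
qed

section \<open>The minimax theorem by separation\<close>

lemma obtain_pmf_of_weights:
  fixes x :: "'a::finite \<Rightarrow> real"
  assumes "\<And>i. 0 \<le> x i" "(\<Sum>i\<in>UNIV. x i) = 1"
  obtains p where "\<And>i. pmf p i = x i"
proof
  show "pmf (embed_pmf x) i = x i" for i
    using assms by (intro pmf_embed_pmf) (auto simp: nn_integral_count_space_finite)
qed

text \<open>Payoffs are linear in the strategy, and a convex combination of strategies is again a
  strategy.\<close>

lemma convex_mixed_payoffs:
  fixes M :: "real ^ 'c ^ 'r"
  shows "convex (range (\<lambda>p. \<chi> j. \<Sum>i\<in>UNIV. pmf p i * M $ i $ j))"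
proof (rule convexI, safe)
  fix p q :: "'r pmf" and u v :: real
  assume uv: "0 \<le> u" "0 \<le> v" "u + v = 1"
  have "(\<Sum>i\<in>UNIV. u * pmf p i + v * pmf q i) = 1"
    using uv by (simp add: sum.distrib sum_pmf_eq_1 flip: sum_distrib_left)
  then obtain r where r: "\<And>i. pmf r i = u * pmf p i + v * pmf q i"
    using uv obtain_pmf_of_weights[of "\<lambda>i. u * pmf p i + v * pmf q i"] by force
  show "u *\<^sub>R (\<chi> j. \<Sum>i\<in>UNIV. pmf p i * M $ i $ j) + v *\<^sub>R (\<chi> j. \<Sum>i\<in>UNIV. pmf q i * M $ i $ j)
      \<in> range (\<lambda>p. \<chi> j. \<Sum>i\<in>UNIV. pmf p i * M $ i $ j)"
    by (rule range_eqI[of _ _ r])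
      (simp add: vec_eq_iff r sum.distrib sum_distrib_left algebra_simps)
qed

lemma game_val_le: "game_val M \<le> mixed_cost M p"
  using game_val_attained[of M] by metis

text \<open>Max's strategy is the normal of a hyperplane that separates the mixed payoff vectors from the
  orthant of vectors with all entries below the value; it is nonnegative since that orthant is
  closed downwards.\<close>

lemma exists_maximin_strategy:
  fixes M :: "real ^ 'c ^ 'r"
  shows "\<exists>q. \<forall>i. game_val M \<le> (\<Sum>j\<in>UNIV. pmf q j * M $ i $ j)"
proof -
  let ?v = "game_val M"
  define C where "C = range (\<lambda>p. \<chi> j. \<Sum>i\<in>UNIV. pmf p i * M $ i $ j)"
  define D where "D = {z :: real ^ 'c. \<forall>j. z $ j < ?v}"
  have "convex D"
  proof (rule convexI)
    fix x y :: "real ^ 'c" and s t :: real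
    assume *: "x \<in> D" "y \<in> D" "0 \<le> s" "0 \<le> t" "s + t = 1"
    show "s *\<^sub>R x + t *\<^sub>R y \<in> D"
      using * by (auto simp: D_def intro!: convex_bound_lt)
  qed
  moreover have "convex C" unfolding C_def by (rule convex_mixed_payoffs)
  moreover have "D \<noteq> {}"
    by (auto simp: D_def intro!: exI[of _ "\<chi> j. ?v - 1"])
  moreover have "C \<noteq> {}" by (simp add: C_def)
  moreover have "D \<inter> C = {}"
  proof -
    have False if "\<And>j. (\<Sum>i\<in>UNIV. pmf p i * M $ i $ j) < ?v" for p
    proof -
      have "mixed_cost M p < ?v" unfolding mixed_cost_def using that by simp
      then show False using game_val_le[of M p] by simp
    qed
    then show ?thesis by (force simp: C_def D_def)
  qed
  ultimately obtain a b where ab: "a \<noteq> 0" "\<And>z. z \<in> D \<Longrightarrow> a \<bullet> z \<le> b" "\<And>z. z \<in> C \<Longrightarrow> b \<le> a \<bullet> z"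
    using separating_hyperplane_sets[of D C] by metis
  \<comment> \<open>These points of \<open>D\<close> serve twice: large \<open>t\<close> with
    \<open>e = 1\<close> forces \<open>0 \<le> a $ j\<close>, and \<open>t = 0\<close> with small
    \<open>e\<close> gives \<open>?v * ?s \<le> b\<close>.\<close>
  have in_D: "a \<bullet> ((\<chi> j. ?v - e) - t *\<^sub>R axis j 1) \<le> b" if "0 < e" "0 \<le> t" for e t j
    using that by (intro ab(2)) (auto simp: D_def axis_def)
  let ?s = "\<Sum>j\<in>UNIV. a $ j"
  have inner_const: "a \<bullet> (\<chi> j. c) = c * ?s" for c
    by (simp add: inner_vec_def sum_distrib_left mult.commute)
  have a_nonneg: "0 \<le> a $ j" for j
  proof (rule ccontr)
    assume "\<not> 0 \<le> a $ j"
    then have neg: "a $ j < 0" by simp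
    \<comment> \<open>Chosen so that \<open>- (t * a $ j)\<close> exceeds
      \<open>b - (?v - 1) * ?s\<close>, which contradicts \<open>in_D\<close>.\<close>
    define t where "t = (\<bar>b - (?v - 1) * ?s\<bar> + 1) / (- a $ j)"
    have "0 \<le> t" unfolding t_def using neg by (intro divide_nonneg_nonneg) auto
    then have "(?v - 1) * ?s - t * a $ j \<le> b"
      using in_D[of 1 t j] by (simp add: inner_diff_right inner_const inner_axis)
    moreover have "- (t * a $ j) = \<bar>b - (?v - 1) * ?s\<bar> + 1"
      unfolding t_def using neg by (simp add: field_simps)
    ultimately show False by linarith
  qed
  have "?s \<noteq> 0" using ab(1) a_nonneg by (auto simp: sum_nonneg_eq_0_iff vec_eq_iff)
  then have s: "0 < ?s" using sum_nonneg[of UNIV "($) a"] a_nonneg by simp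
  have v_le_b: "?v * ?s \<le> b"
  proof (rule field_le_epsilon)
    fix e :: real assume "0 < e"
    then have "(?v - e / ?s) * ?s \<le> b"
      using in_D[of "e / ?s" 0] s by (simp add: inner_const)
    then show "?v * ?s \<le> b + e" using s by (simp add: left_diff_distrib)
  qed
  obtain q where q: "\<And>j. pmf q j = a $ j / ?s"
    using a_nonneg s obtain_pmf_of_weights[of "\<lambda>j. a $ j / ?s"]
    by (force simp flip: sum_divide_distrib)
  have "?v \<le> (\<Sum>j\<in>UNIV. pmf q j * M $ i $ j)" for i
  proof -
    \<comment> \<open>A row is the payoff vector of a pure strategy.\<close>
    have "M $ i \<in> C" unfolding C_def
      by (rule range_eqI[of _ _ "return_pmf i"]) (simp add: vec_eq_iff pmf_return indicator_def)
    then have "?v * ?s \<le> (\<Sum>j\<in>UNIV. a $ j * M $ i $ j)"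
      using v_le_b ab(3)[of "M $ i"] by (simp add: inner_vec_def)
    then show ?thesis using s by (simp add: q field_simps flip: sum_divide_distrib)
  qed
  then show ?thesis by blast
qed

text \<open>For \<open>\<le>\<close>, a maximin strategy of Max is a strategy of Min in the new
  game. For \<open>\<ge>\<close>, weak duality: the expected payoff of optimal \<open>p\<close>
  against \<open>q'\<close>, summed in either order, lies between
  \<open>- game_val (- transpose M)\<close> and \<open>game_val M\<close>.\<close>

lemma game_val_minus_transpose:
  fixes M :: "real ^ 'c ^ 'r"
  shows "game_val (- transpose M) = - game_val M"
proof (rule antisym)
  obtain q where q: "\<And>i. game_val M \<le> (\<Sum>j\<in>UNIV. pmf q j * M $ i $ j)"
    using exists_maximin_strategy by blast
  have "mixed_cost (- transpose M) q \<le> - game_val M"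
    unfolding mixed_cost_def using q by (auto simp: transpose_def sum_negf)
  then show "game_val (- transpose M) \<le> - game_val M"
    using game_val_le[of "- transpose M" q] by linarith
  obtain p where p: "mixed_cost M p = game_val M" using game_val_attained by blast
  obtain q' where q': "mixed_cost (- transpose M) q' = game_val (- transpose M)"
    using game_val_attained by blast
  have "- (\<Sum>j\<in>UNIV. pmf q' j * M $ i $ j) \<le> game_val (- transpose M)" for i
    using sum_pmf_le_mixed_cost[of q' "- transpose M" i] q' by (simp add: transpose_def sum_negf)
  then have "(\<Sum>i\<in>UNIV. pmf p i * - game_val (- transpose M))
      \<le> (\<Sum>i\<in>UNIV. pmf p i * (\<Sum>j\<in>UNIV. pmf q' j * M $ i $ j))"
    by (intro sum_mono mult_left_mono) (auto simp: minus_le_iff)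
  also have "\<dots> = (\<Sum>j\<in>UNIV. pmf q' j * (\<Sum>i\<in>UNIV. pmf p i * M $ i $ j))"
    unfolding sum_distrib_left by (subst sum.swap) (simp add: mult_ac)
  also have "\<dots> \<le> (\<Sum>j\<in>UNIV. pmf q' j * game_val M)"
    using sum_pmf_le_mixed_cost[of p M] p by (intro sum_mono mult_left_mono) auto
  finally show "- game_val M \<le> game_val (- transpose M)"
    by (simp add: sum_pmf_eq_1 sum_negf flip: sum_distrib_right)
qed

section \<open>Passage to the negated transpose\<close>

lemma Min_uminus:
  fixes f :: "'a \<Rightarrow> real"
  assumes "finite A" "A \<noteq> {}"
  shows "(MIN x\<in>A. - f x) = - (MAX x\<in>A. f x)"
  using minus_Max_eq_Min[of "f ` A"] assms by (simp add: image_image)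

lemma Max_uminus:
  fixes f :: "'a \<Rightarrow> real"
  assumes "finite A" "A \<noteq> {}"
  shows "(MAX x\<in>A. - f x) = - (MIN x\<in>A. f x)"
  using minus_Min_eq_Max[of "f ` A"] assms by (simp add: image_image)

lemma min_entry_minus_transpose: "min_entry (- transpose M) = - max_entry M"
proof -
  have "range (\<lambda>(i, j). (- transpose M) $ i $ j) = range (\<lambda>x. - (case x of (i, j) \<Rightarrow> M $ i $ j))"
    by (auto simp: transpose_def image_iff) blast+
  then show ?thesis
    unfolding min_entry_def max_entry_def
    using Min_uminus[of UNIV "\<lambda>(i, j). M $ i $ j", OF finite UNIV_not_empty] by (simp only:)
qed

lemma collection_cost_minus_transpose:
  fixes M :: "real ^ 'c ^ 'r"
  assumes "0 < k"
  shows "collection_cost k (- transpose M) = - collection_gain k M"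
proof -
  have ne: "multisets_of_size (UNIV :: 'c set) k \<noteq> {}"
    by (auto simp: multisets_of_size_def intro!: exI[of _ "replicate_mset k undefined"])
  have "(MAX j. MIN i\<in>set_mset S. (- transpose M) $ i $ j)
      = - (MIN i. MAX j\<in>set_mset S. M $ i $ j)" if "S \<in> multisets_of_size UNIV k" for S
  proof -
    \<comment> \<open>Negation exchanges \<open>Min\<close> and \<open>Max\<close> on nonempty sets
      only; here \<open>0 < k\<close> enters.\<close>
    have "set_mset S \<noteq> {}" using that assms by (auto simp: multisets_of_size_def)
    then show ?thesis by (simp add: transpose_def Min_uminus Max_uminus
          del: minus_Max_eq_Min minus_Min_eq_Max)
  qed
  then have "collection_cost k (- transpose M)
      = (MIN S\<in>multisets_of_size UNIV k. - (MIN i. MAX j\<in>set_mset S. M $ i $ j))"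
    unfolding collection_cost_def by (intro arg_cong[where f = Min] image_cong) auto
  also have "\<dots> = - collection_gain k M"
    unfolding collection_gain_def using ne by (intro Min_uminus finite_multisets_of_size) auto
  finally show ?thesis .
qed

section \<open>Degenerate case and conclusion\<close>

lemma min_entry_le_game_val: "min_entry M \<le> game_val M"
proof -
  obtain p where p: "mixed_cost M p = game_val M" using game_val_attained by blast
  have "min_entry M = (\<Sum>i\<in>UNIV. pmf p i * min_entry M)"
    by (simp add: sum_pmf_eq_1 flip: sum_distrib_right)
  also have "\<dots> \<le> (\<Sum>i\<in>UNIV. pmf p i * M $ i $ undefined)"
    by (intro sum_mono mult_left_mono min_entry_le) simp
  also have "\<dots> \<le> game_val M" using sum_pmf_le_mixed_cost p by metis
  finally show ?thesis .
qed

text \<open>If the value equals the least entry, the bound is attained for every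
  \<open>k > 0\<close>; hence the guard \<open>min_entry M < game_val M\<close> on the equality
  claim.\<close>

lemma collection_cost_le_and_eq_case:
  fixes M :: "real ^ 'c ^ 'r"
  assumes "\<epsilon> > 0" "k > 0" "log (1 + \<epsilon>) (real CARD('c)) \<le> real k"
  shows "collection_cost k M \<le> game_val M + \<epsilon> * (game_val M - min_entry M) \<and>
    (min_entry M < game_val M \<longrightarrow>
      collection_cost k M = game_val M + \<epsilon> * (game_val M - min_entry M) \<longrightarrow>
      real k = log (1 + \<epsilon>) (real CARD('c)))"
proof (cases "min_entry M < game_val M")
  case True
  then show ?thesis using collection_cost_bound[OF assms(1,2) True assms(3)] assms(3) by fastforce
next
  case False
  then have "game_val M = min_entry M" using min_entry_le_game_val[of M] by simp
  then show ?thesis using collection_cost_degenerate assms(2) by fastforce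
qed

theorem theorem3:
  fixes M :: "real ^ 'c ^ 'r" and \<epsilon> :: real and k :: nat
  assumes "\<epsilon> > 0" and "k > 0"
  shows
    "(log (1 + \<epsilon>) (real CARD('c)) \<le> real k \<longrightarrow>
        collection_cost k M \<le> game_val M + \<epsilon> * (game_val M - min_entry M) \<and>
        (min_entry M < game_val M \<longrightarrow>
          collection_cost k M = game_val M + \<epsilon> * (game_val M - min_entry M) \<longrightarrow>
          real k = log (1 + \<epsilon>) (real CARD('c)))) \<and>
     (log (1 + \<epsilon>) (real CARD('r)) \<le> real k \<longrightarrow>
        collection_gain k M \<ge> game_val M - \<epsilon> * (max_entry M - game_val M) \<and>
        (game_val M < max_entry M \<longrightarrow>
          collection_gain k M = game_val M - \<epsilon> * (max_entry M - game_val M) \<longrightarrow>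
          real k = log (1 + \<epsilon>) (real CARD('r))))"
  \<comment> \<open>\<open>- transpose M\<close> has \<open>CARD('r)\<close> columns and least entry
    \<open>- max_entry M\<close>, so its guard becomes
    \<open>game_val M < max_entry M\<close>.\<close>
  using collection_cost_le_and_eq_case[OF assms, of M]
    collection_cost_le_and_eq_case[OF assms, of "- transpose M"]
  by (auto simp: game_val_minus_transpose min_entry_minus_transpose
      collection_cost_minus_transpose[OF assms(2)] algebra_simps)

end
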